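(* Let $\Psi$ be the multiset of $T$-weights of a $P$-stable subspace $N$ of a finite-dimensional rational $G$-module, and assume that the $T$-weights of $N$ lie in an open half-space of $\mathfrak X\otimes_{\mathbb Z}\mathbb Q$. Then for all $\lambda\in\mathfrak X_+$ and $\mu\in\mathfrak X$, $$\frac{d}{dq}\,\mathfrak m_{\lambda,\Psi}^\mu(q)=\sum_{\gamma\in\Psi}\sum_{n\ge 1}q^{n-1}\,\mathfrak m_{\lambda,\Psi}^{\mu+n\gamma}(q).$$
   Context: $G$ is a connected semisimple algebraic group over $\mathbb C$ with Borel subgroup $B$ and maximal torus $T\subset B$; $P\supset B$ is a parabolic subgroup; $\mathfrak X$ is the character group of $T$; the positive roots are the roots of $B$; $\mathfrak X_+$ is the monoid of dominant weights; $\rho$ is the half-sum of positive roots; $W$ is the Weyl group with length function $\ell$ and $\varepsilon(w)=(-1)^{\ell(w)}$. The $q$-partition function is defined by $\prod_{\alpha\in\Psi}(1-qe^\alpha)^{-1}=\sum_\nu\mathcal P_{\Psi,q}(\nu)e^\nu$ (products and sums over $\Psi$ taken with multiplicities), and $$\mathfrak m^\mu_{\lambda,\Psi}(q)=\sum_{w\in W}\varepsilon(w)\,\mathcal P_{\Psi,q}\bigl(w(\lambda+\rho)-(\mu+\rho)\bigr).$$ *)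

theory Defs
  imports
    "HOL-Analysis.Analysis"
    "HOL-Algebra.Solvable_Groups"
    "HOL-Algebra.Group_Action"
    "HOL-Library.Poly_Mapping"
    "HOL-Library.Multiset"
    "HOL-Computational_Algebra.Formal_Power_Series"
    "HOL-Computational_Algebra.Polynomial"
begin

section \<open>Multiples, and the tensor product of an abelian group with the rationals\<close>

definition nmul :: "nat \<Rightarrow> 'a::ab_group_add \<Rightarrow> 'a"
  where "nmul n a = (\<Sum>i<n. a)"

definition zmul :: "int \<Rightarrow> 'a::ab_group_add \<Rightarrow> 'a"
  where "zmul k a = nmul (nat k) a - nmul (nat (- k)) a"

lemma nmul_0 [simp]: "nmul 0 a = 0"
  and nmul_Suc: "nmul (Suc n) a = a + nmul n a"
  and nmul_one [simp]: "nmul (Suc 0) a = a"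
  by (simp_all add: nmul_def add.commute)

lemma nmul_zero [simp]: "nmul n 0 = 0"
  by (simp add: nmul_def)

lemma nmul_add: "nmul n (a + b) = nmul n a + nmul n b"
  by (simp add: nmul_def sum.distrib)

lemma nmul_uminus: "nmul n (- a) = - nmul n a"
  by (simp add: nmul_def sum_negf)

lemma nmul_add_left: "nmul (m + n) a = nmul m a + nmul n a"
  by (induction m) (simp_all add: nmul_Suc add.assoc)

lemma nmul_nmul: "nmul m (nmul n a) = nmul (m * n) a"
  by (induction m) (simp_all add: nmul_Suc nmul_add_left)

text \<open>
  Pairs \<open>(a, m)\<close> with \<open>m > 0\<close> stand for \<open>a / m\<close>. This is the localisation of the \<open>\<int>\<close>-module
  \<open>'a\<close> at the positive integers, i.e. \<open>'a \<otimes>\<^sub>\<int> \<rat>\<close>; the factor \<open>k\<close> is needed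
  because \<open>'a\<close> may have torsion.
\<close>

definition qfrac_rel :: "'a::ab_group_add \<times> nat \<Rightarrow> 'a \<times> nat \<Rightarrow> bool"
  where "qfrac_rel x y \<longleftrightarrow> 0 < snd x \<and> 0 < snd y \<and>
    (\<exists>k>0. nmul (k * snd y) (fst x) = nmul (k * snd x) (fst y))"

lemma part_equivp_qfrac_rel: "part_equivp (qfrac_rel :: 'a::ab_group_add \<times> nat \<Rightarrow> _)"
proof (rule part_equivpI)
  show "\<exists>x :: 'a \<times> nat. qfrac_rel x x"
    by (rule exI[of _ "(0, 1)"]) (auto simp: qfrac_rel_def)
  show "symp (qfrac_rel :: 'a \<times> nat \<Rightarrow> _)"
    by (rule sympI) (auto simp: qfrac_rel_def)
  show "transp (qfrac_rel :: 'a \<times> nat \<Rightarrow> _)"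
  proof (rule transpI)
    fix x y z :: "'a \<times> nat"
    assume "qfrac_rel x y" "qfrac_rel y z"
    then obtain k l where pos: "0 < snd x" "0 < snd y" "0 < snd z" "0 < k" "0 < l"
      and k: "nmul (k * snd y) (fst x) = nmul (k * snd x) (fst y)"
      and l: "nmul (l * snd z) (fst y) = nmul (l * snd y) (fst z)"
      unfolding qfrac_rel_def by blast
    let ?j = "k * l * snd y"
    have "nmul (?j * snd z) (fst x) = nmul (l * snd z) (nmul (k * snd y) (fst x))"
      by (simp add: nmul_nmul mult_ac)
    also have "\<dots> = nmul (k * snd x) (nmul (l * snd z) (fst y))"
      by (simp add: k nmul_nmul mult_ac)
    also have "\<dots> = nmul (?j * snd x) (fst z)"
      by (simp add: l nmul_nmul mult_ac)
    finally show "qfrac_rel x z"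
      using pos unfolding qfrac_rel_def by (intro conjI exI[of _ ?j]) simp_all
  qed
qed

quotient_type (overloaded) 'a ratn = "'a::ab_group_add \<times> nat" / partial: qfrac_rel
  by (rule part_equivp_qfrac_rel)

text \<open>\<open>qfrac a m\<close> is \<open>a / m\<close>; the value for \<open>m = 0\<close> is junk.\<close>

lift_definition qfrac :: "'a::ab_group_add \<Rightarrow> nat \<Rightarrow> 'a ratn"
  is "\<lambda>a m. if m = 0 then (0, 1) else (a, m)"
  by (auto simp: qfrac_rel_def)

abbreviation \<iota> :: "'a::ab_group_add \<Rightarrow> 'a ratn"
  where "\<iota> a \<equiv> qfrac a 1"

instantiation ratn :: (ab_group_add) ab_group_add
begin

lift_definition zero_ratn :: "'a ratn" is "(0, 1)"
  by (auto simp: qfrac_rel_def)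

lift_definition plus_ratn :: "'a ratn \<Rightarrow> 'a ratn \<Rightarrow> 'a ratn"
  is "\<lambda>x y. (nmul (snd y) (fst x) + nmul (snd x) (fst y), snd x * snd y)"
proof -
  fix x x' y y' :: "'a \<times> nat"
  assume "qfrac_rel x x'" "qfrac_rel y y'"
  then obtain k l where pos: "0 < snd x" "0 < snd x'" "0 < snd y" "0 < snd y'" "0 < k" "0 < l"
    and k: "nmul (k * snd x') (fst x) = nmul (k * snd x) (fst x')"
    and l: "nmul (l * snd y') (fst y) = nmul (l * snd y) (fst y')"
    unfolding qfrac_rel_def by blast
  have 1: "nmul (k * l * (snd x' * snd y')) (nmul (snd y) (fst x))
      = nmul (k * l * (snd x * snd y)) (nmul (snd y') (fst x'))"
  proof -
    have "nmul (k * l * (snd x' * snd y')) (nmul (snd y) (fst x))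
        = nmul (l * snd y' * snd y) (nmul (k * snd x') (fst x))"
      by (simp add: nmul_nmul mult_ac)
    then show ?thesis
      by (simp add: k nmul_nmul mult_ac)
  qed
  have 2: "nmul (k * l * (snd x' * snd y')) (nmul (snd x) (fst y))
      = nmul (k * l * (snd x * snd y)) (nmul (snd x') (fst y'))"
  proof -
    have "nmul (k * l * (snd x' * snd y')) (nmul (snd x) (fst y))
        = nmul (k * snd x' * snd x) (nmul (l * snd y') (fst y))"
      by (simp add: nmul_nmul mult_ac)
    then show ?thesis
      by (simp add: l nmul_nmul mult_ac)
  qed
  have "nmul (k * l * (snd x' * snd y')) (nmul (snd y) (fst x) + nmul (snd x) (fst y))
      = nmul (k * l * (snd x * snd y)) (nmul (snd y') (fst x') + nmul (snd x') (fst y'))"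
    by (simp only: nmul_add 1 2)
  then show "qfrac_rel (nmul (snd y) (fst x) + nmul (snd x) (fst y), snd x * snd y)
      (nmul (snd y') (fst x') + nmul (snd x') (fst y'), snd x' * snd y')"
    using pos unfolding qfrac_rel_def fst_conv snd_conv
    by (intro conjI exI[of _ "k * l"]) simp_all
qed

lift_definition uminus_ratn :: "'a ratn \<Rightarrow> 'a ratn" is "\<lambda>x. (- fst x, snd x)"
  by (auto simp: qfrac_rel_def nmul_uminus)

definition minus_ratn :: "'a ratn \<Rightarrow> 'a ratn \<Rightarrow> 'a ratn"
  where "minus_ratn x y = x + - y"

instance
proof
  fix a b c :: "'a ratn"
  show "a + b + c = a + (b + c)"
    by transfer (auto simp: qfrac_rel_def nmul_add nmul_nmul mult_ac add_ac)
  show "a + b = b + a"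
    by transfer (auto simp: qfrac_rel_def mult_ac add_ac)
  show "0 + a = a"
    by transfer (auto simp: qfrac_rel_def)
  show "- a + a = 0"
    by transfer (auto simp: qfrac_rel_def nmul_uminus)
  show "a - b = a + - b"
    by (simp add: minus_ratn_def)
qed

end

text \<open>
  The \<open>\<rat>\<close>-linear extension of an additive map \<open>f\<close> to \<open>'a ratn\<close>.
\<close>

definition map_ratn :: "('a::ab_group_add \<Rightarrow> 'b::ab_group_add) \<Rightarrow> 'a ratn \<Rightarrow> 'b ratn"
  where "map_ratn f x = (case rep_ratn x of (a, m) \<Rightarrow> qfrac (f a) m)"

text \<open>
  For a subgroup \<open>X\<close>, the \<open>\<rat>\<close>-subspace \<open>X \<otimes> \<rat>\<close> of \<open>'a ratn\<close>
  (\<open>\<rat>\<close> is flat over \<open>\<int>\<close>).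
\<close>

definition rat_span :: "'a::ab_group_add set \<Rightarrow> 'a ratn set"
  where "rat_span X = {qfrac a m | a m. a \<in> X \<and> 0 < m}"

text \<open>Additive maps between \<open>\<rat>\<close>-vector spaces are automatically \<open>\<rat>\<close>-linear.\<close>

definition open_half_space :: "'a::ab_group_add ratn set \<Rightarrow> 'a ratn set \<Rightarrow> bool"
  where "open_half_space V H \<longleftrightarrow>
    (\<exists>\<phi> :: 'a ratn \<Rightarrow> rat. (\<forall>x\<in>V. \<forall>y\<in>V. \<phi> (x + y) = \<phi> x + \<phi> y) \<and>
      (\<exists>x\<in>V. \<phi> x \<noteq> 0) \<and> H = {x \<in> V. 0 < \<phi> x})"


section \<open>The q-partition function\<close>

text \<open>
  The identity \<open>\<Prod>\<^sub>\<alpha> (1 - q e\<^sup>\<alpha>)\<^sup>-\<^sup>1 = \<Sum>\<^sub>\<nu> P(\<nu>) e\<^sup>\<nu>\<close> is read in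
  \<open>\<int>[A][[q]]\<close>, where \<open>\<int>[A]\<close> is the group ring (finitely supported functions with
  convolution); there every factor \<open>1 - q e\<^sup>\<alpha>\<close> is a unit. The coefficient of \<open>e\<^sup>\<nu>\<close> is
  a power series in \<open>q\<close>, which is a polynomial when \<open>\<Psi>\<close> lies in an open half-space;
  without that \<open>Abs_poly\<close> need not return anything meaningful.
\<close>

definition ring_inv :: "'a::comm_ring_1 \<Rightarrow> 'a"
  where "ring_inv u = (THE v. u * v = 1)"

definition q_partition_series :: "'a::ab_group_add multiset \<Rightarrow> ('a \<Rightarrow>\<^sub>0 int) fps"
  where "q_partition_series \<Psi> =
    (\<Prod>\<alpha>\<in>#\<Psi>. ring_inv (1 - fps_X * fps_const (Poly_Mapping.single \<alpha> 1)))"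

definition q_partition :: "'a::ab_group_add multiset \<Rightarrow> 'a \<Rightarrow> int poly"
  where "q_partition \<Psi> \<nu> =
    Abs_poly (\<lambda>k. Poly_Mapping.lookup (fps_nth (q_partition_series \<Psi>) k) \<nu>)"


section \<open>Linear algebraic groups over the complex numbers\<close>

type_synonym 'n mat = "complex^'n^'n"

inductive_set polyfun :: "('n::finite mat \<Rightarrow> complex) set" where
  const: "(\<lambda>A. c) \<in> polyfun"
| entry: "(\<lambda>A. A $ i $ j) \<in> polyfun"
| add: "f \<in> polyfun \<Longrightarrow> g \<in> polyfun \<Longrightarrow> (\<lambda>A. f A + g A) \<in> polyfun"
| mult: "f \<in> polyfun \<Longrightarrow> g \<in> polyfun \<Longrightarrow> (\<lambda>A. f A * g A) \<in> polyfun"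

definition zariski_open :: "'n::finite mat set \<Rightarrow> bool"
  where "zariski_open U \<longleftrightarrow> (\<exists>F \<subseteq> polyfun. U = {A. \<exists>f\<in>F. f A \<noteq> 0})"

lemma istopology_zariski_open: "istopology zariski_open"
  unfolding istopology_def
proof (intro conjI allI impI)
  fix S T :: "'a mat set"
  assume "zariski_open S" "zariski_open T"
  then obtain F G where "F \<subseteq> polyfun" "S = {A. \<exists>f\<in>F. f A \<noteq> 0}"
      "G \<subseteq> polyfun" "T = {A. \<exists>f\<in>G. f A \<noteq> 0}"
    unfolding zariski_open_def by blast
  then have "{\<lambda>A. f A * g A | f g. f \<in> F \<and> g \<in> G} \<subseteq> polyfun \<and>
      S \<inter> T = {A. \<exists>h\<in>{\<lambda>A. f A * g A | f g. f \<in> F \<and> g \<in> G}. h A \<noteq> 0}"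
    by (fastforce intro: polyfun.mult)
  then show "zariski_open (S \<inter> T)"
    unfolding zariski_open_def by blast
next
  fix \<K> :: "'a mat set set"
  assume "\<forall>K\<in>\<K>. zariski_open K"
  then have K: "\<exists>F \<subseteq> polyfun. K = {A. \<exists>f\<in>F. f A \<noteq> 0}" if "K \<in> \<K>" for K
    using that unfolding zariski_open_def by blast
  let ?F = "{f \<in> polyfun. {A. f A \<noteq> 0} \<subseteq> \<Union>\<K>}"
  have "\<Union>\<K> \<subseteq> {A. \<exists>f\<in>?F. f A \<noteq> 0}"
  proof
    fix A assume "A \<in> \<Union>\<K>"
    then obtain K where "K \<in> \<K>" "A \<in> K" by blast
    with K[of K] obtain f where f: "f \<in> polyfun" "f A \<noteq> 0" "{A. f A \<noteq> 0} \<subseteq> K" by blast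
    have "f \<in> ?F" using f \<open>K \<in> \<K>\<close> by blast
    with f show "A \<in> {A. \<exists>f\<in>?F. f A \<noteq> 0}" by blast
  qed
  then have "\<Union>\<K> = {A. \<exists>f\<in>?F. f A \<noteq> 0}"
    by blast
  then show "zariski_open (\<Union>\<K>)"
    unfolding zariski_open_def by (intro exI[of _ ?F]) auto
qed

definition zariski :: "'n::finite mat topology"
  where "zariski = topology zariski_open"

definition GL :: "'n::finite mat monoid"
  where "GL = \<lparr>carrier = {A. invertible A}, mult = (**), one = mat 1\<rparr>"

abbreviation grp :: "'n::finite mat set \<Rightarrow> 'n mat monoid"
  where "grp H \<equiv> GL\<lparr>carrier := H\<rparr>"

definition alg_group :: "'n::finite mat set \<Rightarrow> bool"
  where "alg_group H \<longleftrightarrow> subgroup H GL \<and> closedin (subtopology zariski (carrier GL)) H"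

definition regular_on :: "'n::finite mat set \<Rightarrow> ('n mat \<Rightarrow> complex) \<Rightarrow> bool"
  where "regular_on H f \<longleftrightarrow> (\<exists>p\<in>polyfun. \<exists>k::nat. \<forall>A\<in>H. f A = p A / det A ^ k)"

definition alg_hom :: "'n::finite mat set \<Rightarrow> 'm::finite mat set \<Rightarrow> ('n mat \<Rightarrow> 'm mat) \<Rightarrow> bool"
  where "alg_hom H K f \<longleftrightarrow> f \<in> hom (grp H) (grp K) \<and>
    (\<forall>i j. regular_on H (\<lambda>A. f A $ i $ j))"

text \<open>
  The trivial group counts as semisimple. The radical is trivial iff there is no non-trivial
  closed connected solvable normal subgroup.
\<close>

definition connected_semisimple :: "'n::finite mat set \<Rightarrow> bool"
  where "connected_semisimple G \<longleftrightarrow> alg_group G \<and> connectedin zariski G \<and>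
    (\<forall>R. alg_group R \<and> connectedin zariski R \<and> R \<lhd> grp G \<and> solvable (grp R) \<longrightarrow> R = {mat 1})"

definition conn_solvable_subgroup :: "'n::finite mat set \<Rightarrow> 'n mat set \<Rightarrow> bool"
  where "conn_solvable_subgroup G H \<longleftrightarrow>
    alg_group H \<and> H \<subseteq> G \<and> connectedin zariski H \<and> solvable (grp H)"

definition borel_subgroup :: "'n::finite mat set \<Rightarrow> 'n mat set \<Rightarrow> bool"
  where "borel_subgroup G B \<longleftrightarrow> conn_solvable_subgroup G B \<and>
    (\<forall>H. conn_solvable_subgroup G H \<and> B \<subseteq> H \<longrightarrow> H = B)"

definition parabolic_subgroup :: "'n::finite mat set \<Rightarrow> 'n mat set \<Rightarrow> bool"
  where "parabolic_subgroup G P \<longleftrightarrow> alg_group P \<and> P \<subseteq> G \<and> (\<exists>B. borel_subgroup G B \<and> B \<subseteq> P)"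

text \<open>
  The standard tori \<open>\<G>\<^sub>m\<^sup>r\<close>, \<open>r = card S\<close>, as groups of diagonal matrices. A torus in
  \<open>GL\<^sub>n\<close> is diagonalisable, hence of rank at most \<open>n\<close>, so these suffice.
\<close>

definition std_torus :: "'n::finite set \<Rightarrow> 'n mat set"
  where "std_torus S = {A. (\<forall>i j. i \<noteq> j \<longrightarrow> A $ i $ j = 0) \<and> (\<forall>i. A $ i $ i \<noteq> 0) \<and>
    (\<forall>i. i \<notin> S \<longrightarrow> A $ i $ i = 1)}"

definition torus :: "'n::finite mat set \<Rightarrow> bool"
  where "torus T \<longleftrightarrow> alg_group T \<and>
    (\<exists>S :: 'n set. \<exists>f g. alg_hom T (std_torus S) f \<and> alg_hom (std_torus S) T g \<and>
      (\<forall>t\<in>T. g (f t) = t) \<and> (\<forall>s\<in>std_torus S. f (g s) = s))"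

definition maximal_torus :: "'n::finite mat set \<Rightarrow> 'n mat set \<Rightarrow> bool"
  where "maximal_torus G T \<longleftrightarrow> torus T \<and> T \<subseteq> G \<and>
    (\<forall>S. torus S \<and> S \<subseteq> G \<and> T \<subseteq> S \<longrightarrow> S = T)"


section \<open>Characters and weights\<close>

text \<open>
  Nowhere vanishing functions under pointwise multiplication, written additively. Characters
  of a subgroup \<open>T\<close> are represented by such functions that are \<open>1\<close> off \<open>T\<close>.
\<close>

typedef 'a nvfun = "{f :: 'a \<Rightarrow> complex. \<forall>x. f x \<noteq> 0}"
  morphisms ev Nvfun
  by (rule exI[of _ "\<lambda>_. 1"]) simp

setup_lifting type_definition_nvfun

instantiation nvfun :: (type) ab_group_add
begin

lift_definition zero_nvfun :: "'a nvfun" is "\<lambda>_. 1" by simp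
lift_definition plus_nvfun :: "'a nvfun \<Rightarrow> 'a nvfun \<Rightarrow> 'a nvfun" is "\<lambda>f g x. f x * g x" by simp
lift_definition minus_nvfun :: "'a nvfun \<Rightarrow> 'a nvfun \<Rightarrow> 'a nvfun" is "\<lambda>f g x. f x / g x" by simp
lift_definition uminus_nvfun :: "'a nvfun \<Rightarrow> 'a nvfun" is "\<lambda>f x. inverse (f x)" by simp

instance
  by standard (transfer; simp add: fun_eq_iff field_simps)+

end

type_synonym 'n chr = "'n mat nvfun"

definition char_group :: "'n::finite mat set \<Rightarrow> 'n chr set"
  where "char_group T = {x. regular_on T (ev x) \<and>
    (\<forall>s\<in>T. \<forall>t\<in>T. ev x (s ** t) = ev x s * ev x t) \<and> (\<forall>t. t \<notin> T \<longrightarrow> ev x t = 1)}"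

definition rational_module :: "'n::finite mat set \<Rightarrow> ('n mat \<Rightarrow> 'm::finite mat) \<Rightarrow> bool"
  where "rational_module G rep \<longleftrightarrow> alg_hom G (carrier GL) rep"

definition stable_subspace ::
    "'n::finite mat set \<Rightarrow> ('n mat \<Rightarrow> 'm::finite mat) \<Rightarrow> (complex^'m) set \<Rightarrow> bool"
  where "stable_subspace P rep N \<longleftrightarrow> vec.subspace N \<and> (\<forall>g\<in>P. \<forall>v\<in>N. rep g *v v \<in> N)"

definition weight_space ::
    "'n::finite mat set \<Rightarrow> ('n mat \<Rightarrow> 'm::finite mat) \<Rightarrow> (complex^'m) set \<Rightarrow> 'n chr \<Rightarrow> (complex^'m) set"
  where "weight_space T rep N x = {v \<in> N. \<forall>t\<in>T. rep t *v v = ev x t *s v}"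

definition weights_mset ::
    "'n::finite mat set \<Rightarrow> ('n mat \<Rightarrow> 'm::finite mat) \<Rightarrow> (complex^'m) set \<Rightarrow> 'n chr multiset"
  where "weights_mset T rep N =
    Abs_multiset (\<lambda>x. if x \<in> char_group T then vec.dim (weight_space T rep N x) else 0)"

lemma weight_space_scale:
  assumes "vec.subspace N" "v \<in> weight_space T rep N x"
  shows "c *s v \<in> weight_space T rep N x"
  using assms by (auto simp: weight_space_def vec.scale vec.scale_left_commute vec.subspace_scale)

lemma weight_vectors_sum_zero:
  assumes N: "vec.subspace N" and S: "finite S" "S \<subseteq> char_group T"
    and u: "\<And>x. x \<in> S \<Longrightarrow> u x \<in> weight_space T rep N x" and "(\<Sum>x\<in>S. u x) = 0"
  shows "\<forall>x\<in>S. u x = 0"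
  using S u assms(5)
proof (induction S arbitrary: u rule: finite_induct)
  case (insert y S)
  have zero: "\<forall>x\<in>S. (ev x t - ev y t) *s u x = 0" if t: "t \<in> T" for t
  proof (rule insert.IH)
    show "S \<subseteq> char_group T" using insert.prems by blast
    show "(ev x t - ev y t) *s u x \<in> weight_space T rep N x" if "x \<in> S" for x
      using insert.prems(2)[of x] that by (intro weight_space_scale[OF N]) auto
    have "rep t *v (\<Sum>x\<in>insert y S. u x) = (\<Sum>x\<in>insert y S. rep t *v u x)"
      by (rule vec.sum)
    also have "\<dots> = (\<Sum>x\<in>insert y S. ev x t *s u x)"
      using insert.prems(2) t by (intro sum.cong) (auto simp: weight_space_def)
    finally have "(\<Sum>x\<in>insert y S. ev x t *s u x) = 0"
      by (simp only: insert.prems(3) matrix_vector_mult_0_right)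
    moreover have "(\<Sum>x\<in>insert y S. ev y t *s u x) = 0"
      by (simp only: vec.scale_sum_right[symmetric] insert.prems(3) vec.scale_zero_right)
    ultimately have "(\<Sum>x\<in>insert y S. (ev x t - ev y t) *s u x) = 0"
      by (simp only: vec.scale_left_diff_distrib sum_subtractf diff_self)
    then show "(\<Sum>x\<in>S. (ev x t - ev y t) *s u x) = 0"
      using insert.hyps by simp
  qed
  have "u x = 0" if x: "x \<in> S" for x
  proof -
    have "x \<noteq> y" using x insert.hyps by blast
    then have "ev x \<noteq> ev y" by (simp add: ev_inject)
    then obtain t where t: "ev x t \<noteq> ev y t" by blast
    then have "t \<in> T" using x insert.prems(1) by (fastforce simp: char_group_def)
    with zero x t show ?thesis by (metis right_minus_eq vec.scale_eq_0_iff)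
  qed
  then show ?case using insert.prems(3) insert.hyps by simp
qed simp

lemma finite_weights:
  assumes N: "vec.subspace N"
  shows "finite {x \<in> char_group T. 0 < vec.dim (weight_space T rep (N :: (complex^'m) set) x)}"
    (is "finite ?W")
proof (rule ccontr)
  assume "infinite ?W"
  then obtain S where S: "S \<subseteq> ?W" "finite S" "card S = Suc CARD('m)"
    using infinite_arbitrarily_large by blast
  have "\<exists>v. v \<in> weight_space T rep N x \<and> v \<noteq> 0" if "x \<in> S" for x
  proof (rule ccontr)
    assume "\<not> ?thesis"
    then have "weight_space T rep N x \<subseteq> vec.span {}" by auto
    then have "vec.dim (weight_space T rep N x) \<le> card ({} :: (complex^'m) set)"
      by (intro vec.dim_le_card) auto
    moreover have "0 < vec.dim (weight_space T rep N x)" using S that by blast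
    ultimately show False by (simp only: card.empty)
  qed
  then obtain v where v: "\<And>x. x \<in> S \<Longrightarrow> v x \<in> weight_space T rep N x \<and> v x \<noteq> 0"
    by metis
  have ind: "\<forall>x\<in>S. c x = 0" if "(\<Sum>x\<in>S. c x *s v x) = 0" for c
  proof -
    have "\<forall>x\<in>S. c x *s v x = 0"
    proof (rule weight_vectors_sum_zero[OF N S(2)])
      show "S \<subseteq> char_group T" using S by blast
      show "c x *s v x \<in> weight_space T rep N x" if "x \<in> S" for x
        using v[OF that] by (intro weight_space_scale[OF N]) auto
    qed (fact that)
    then show ?thesis using v by simp
  qed
  have inj: "inj_on v S"
  proof (rule inj_onI, rule ccontr)
    fix x y assume xy: "x \<in> S" "y \<in> S" "v x = v y" "x \<noteq> y"
    define c :: "_ \<Rightarrow> complex" where "c = (\<lambda>z. if z = x then 1 else if z = y then - 1 else 0)"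
    have "(\<Sum>z\<in>S. c z *s v z) = (\<Sum>z\<in>{x, y}. c z *s v z)"
      using xy S by (intro sum.mono_neutral_right) (auto simp: c_def)
    also have "\<dots> = 0" using xy by (simp add: c_def)
    finally have "\<forall>x\<in>S. c x = 0" by (rule ind)
    then show False using xy by (auto simp: c_def)
  qed
  have "vec.independent (v ` S)"
  proof (rule vec.independent_if_scalars_zero)
    fix f w assume f: "(\<Sum>w\<in>v ` S. f w *s w) = 0" and w: "w \<in> v ` S"
    have "(\<Sum>x\<in>S. f (v x) *s v x) = 0"
      using f by (simp add: sum.reindex[OF inj])
    then show "f w = 0" using ind[of "\<lambda>x. f (v x)"] w by auto
  qed (use S in auto)
  then have "card (v ` S) \<le> vec.dim (UNIV :: (complex^'m) set)"
    by (intro vec.independent_card_le_dim) auto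
  then show False using S inj by (simp add: card_image vec.dim_UNIV card_cart_basis)
qed

lemma count_weights_mset:
  assumes "vec.subspace N"
  shows "count (weights_mset T rep N) x =
    (if x \<in> char_group T then vec.dim (weight_space T rep N x) else 0)"
proof -
  have "{x. 0 < (if x \<in> char_group T then vec.dim (weight_space T rep N x) else 0)}
      = {x \<in> char_group T. 0 < vec.dim (weight_space T rep N x)}"
    by auto
  then show ?thesis
    unfolding weights_mset_def using finite_weights[OF assms, of T rep]
    by (subst count_Abs_multiset) simp_all
qed

text \<open>
  The tangent space at the identity, inside all matrices: the differentials at \<open>1\<close> of the
  polynomials vanishing on \<open>H\<close> are required to vanish in direction \<open>A\<close>.
\<close>

definition lie_algebra :: "'n::finite mat set \<Rightarrow> 'n mat set"
  where "lie_algebra H = {A. \<forall>f\<in>polyfun. (\<forall>h\<in>H. f h = 0) \<longrightarrow>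
    ((\<lambda>s. f (\<chi> i j. mat 1 $ i $ j + s * A $ i $ j)) has_field_derivative 0) (at 0)}"

text \<open>Roots of \<open>H\<close> relative to \<open>T\<close>: the non-zero weights of \<open>T\<close> on the Lie algebra of \<open>H\<close>.\<close>

definition roots :: "'n::finite mat set \<Rightarrow> 'n mat set \<Rightarrow> 'n chr set"
  where "roots H T = {\<alpha> \<in> char_group T. \<alpha> \<noteq> 0 \<and>
    (\<exists>A\<in>lie_algebra H. A \<noteq> 0 \<and>
      (\<forall>t\<in>T. t ** A ** matrix_inv t = (\<chi> i j. ev \<alpha> t * A $ i $ j)))}"

definition simple_roots :: "'n::finite mat set \<Rightarrow> 'n mat set \<Rightarrow> 'n chr set"
  where "simple_roots B T =
    {\<alpha> \<in> roots B T. \<not> (\<exists>\<beta>\<in>roots B T. \<exists>\<gamma>\<in>roots B T. \<alpha> = \<beta> + \<gamma>)}"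

definition half_sum_pos_roots :: "'n::finite mat set \<Rightarrow> 'n mat set \<Rightarrow> 'n chr ratn"
  where "half_sum_pos_roots B T = qfrac (\<Sum>\<alpha>\<in>roots B T. \<alpha>) 2"


section \<open>Weyl group, coroots, dominance\<close>

definition weyl :: "'n::finite mat set \<Rightarrow> 'n mat set \<Rightarrow> 'n mat set monoid"
  where "weyl G T = grp (normalizer (grp G) T) Mod T"

text \<open>
  \<open>(w x)(t) = x (n\<^sup>-\<^sup>1 t n)\<close> for any representative \<open>n\<close> of \<open>w\<close>; the choice does not
  matter because \<open>T\<close> is commutative.
\<close>

definition weyl_act :: "'n::finite mat set \<Rightarrow> 'n mat set \<Rightarrow> 'n chr \<Rightarrow> 'n chr"
  where "weyl_act T w x = (let n = SOME n. n \<in> w in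
    Nvfun (\<lambda>t. if t \<in> T then ev x (matrix_inv n ** t ** n) else 1))"

text \<open>
  Cocharacters are algebraic group homomorphisms from the multiplicative group to \<open>T\<close>: their
  entries are Laurent polynomials. The value at \<open>0\<close> is junk, normalised for uniqueness.
\<close>

definition cochar_group :: "'n::finite mat set \<Rightarrow> (complex \<Rightarrow> 'n mat) set"
  where "cochar_group T = {c. c 0 = 0 \<and> (\<forall>z. z \<noteq> 0 \<longrightarrow> c z \<in> T) \<and>
    (\<forall>z w. z \<noteq> 0 \<and> w \<noteq> 0 \<longrightarrow> c (z * w) = c z ** c w) \<and>
    (\<forall>i j. \<exists>p :: complex poly. \<exists>k::nat. \<forall>z. z \<noteq> 0 \<longrightarrow> c z $ i $ j = poly p z / z ^ k)}"

definition pairing :: "'n::finite chr \<Rightarrow> (complex \<Rightarrow> 'n mat) \<Rightarrow> int"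
  where "pairing x c = (THE k. \<forall>z. z \<noteq> 0 \<longrightarrow> ev x (c z) = z powi k)"

definition acts_as_reflection ::
    "'n::finite mat set \<Rightarrow> 'n mat set \<Rightarrow> 'n chr \<Rightarrow> (complex \<Rightarrow> 'n mat) \<Rightarrow> bool"
  where "acts_as_reflection T w \<alpha> c \<longleftrightarrow>
    (\<forall>x\<in>char_group T. weyl_act T w x = x - zmul (pairing x c) \<alpha>)"

text \<open>
  The coroot of \<open>\<alpha>\<close> is the cocharacter \<open>c\<close> with \<open>\<langle>\<alpha>, c\<rangle> = 2\<close> for which the reflection
  \<open>x \<mapsto> x - \<langle>x, c\<rangle> \<alpha>\<close> comes from the Weyl group. It is unique because the Weyl group is finite.
\<close>

definition coroot :: "'n::finite mat set \<Rightarrow> 'n mat set \<Rightarrow> 'n chr \<Rightarrow> (complex \<Rightarrow> 'n mat)"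
  where "coroot G T \<alpha> = (THE c. c \<in> cochar_group T \<and> pairing \<alpha> c = 2 \<and>
    (\<exists>w\<in>carrier (weyl G T). acts_as_reflection T w \<alpha> c))"

definition dominant_weights :: "'n::finite mat set \<Rightarrow> 'n mat set \<Rightarrow> 'n mat set \<Rightarrow> 'n chr set"
  where "dominant_weights G B T =
    {x \<in> char_group T. \<forall>\<alpha>\<in>roots B T. 0 \<le> pairing x (coroot G T \<alpha>)}"

definition simple_reflections :: "'n::finite mat set \<Rightarrow> 'n mat set \<Rightarrow> 'n mat set \<Rightarrow> 'n mat set set"
  where "simple_reflections G B T = {w \<in> carrier (weyl G T).
    \<exists>\<alpha>\<in>simple_roots B T. acts_as_reflection T w \<alpha> (coroot G T \<alpha>)}"

definition weyl_length :: "'n::finite mat set \<Rightarrow> 'n mat set \<Rightarrow> 'n mat set \<Rightarrow> 'n mat set \<Rightarrow> nat"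
  where "weyl_length G B T w = (LEAST k. \<exists>ws. length ws = k \<and>
    set ws \<subseteq> simple_reflections G B T \<and> w = foldr (mult (weyl G T)) ws (one (weyl G T)))"

text \<open>
  \<open>m\<^sup>\<mu>\<^sub>\<lambda>\<^sub>,\<^sub>\<Psi>\<close>. The argument \<open>w(\<lambda> + \<rho>) - (\<mu> + \<rho>)\<close> is formed in \<open>X \<otimes> \<rat>\<close>, so
  \<open>\<Psi>\<close> is transported there along \<open>\<iota>\<close>, which is injective on the torsion-free group \<open>X\<close>.
\<close>

definition mpoly ::
    "'n::finite mat set \<Rightarrow> 'n mat set \<Rightarrow> 'n mat set \<Rightarrow> 'n chr multiset \<Rightarrow> 'n chr \<Rightarrow> 'n chr \<Rightarrow> int poly"
  where "mpoly G B T \<Psi> lam \<mu> = (let \<rho> = half_sum_pos_roots B T in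
    \<Sum>w\<in>carrier (weyl G T). (- 1) ^ weyl_length G B T w *
      q_partition (image_mset \<iota> \<Psi>) (map_ratn (weyl_act T w) (\<iota> lam + \<rho>) - (\<iota> \<mu> + \<rho>)))"

end

theory Submission
  imports Defs
begin

text \<open>
  Differentiating the generating function \<open>S = \<Prod>\<^sub>\<gamma> (1 - q e\<^sup>\<gamma>)\<^sup>-\<^sup>1\<close>
  logarithmically gives \<open>dS/dq = (\<Sum>\<^sub>\<gamma> e\<^sup>\<gamma> / (1 - q e\<^sup>\<gamma>)) S\<close>, and expanding the geometric series
  and comparing coefficients of \<open>e\<^sup>\<nu>\<close> yields
  \<open>d/dq P(\<nu>) = \<Sum>\<^sub>\<gamma> \<Sum>\<^sub>n q\<^sup>n\<^sup>-\<^sup>1 P(\<nu> - n\<gamma>)\<close> with \<open>n \<ge> 1\<close>.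
  The theorem is the alternating sum over the Weyl group of these identities at
  \<open>\<nu> = w(\<lambda> + \<rho>) - (\<mu> + \<rho>)\<close>, because replacing \<open>\<mu>\<close> by \<open>\<mu> + n\<gamma>\<close> subtracts \<open>n\<gamma>\<close> from \<open>\<nu>\<close>
  for every \<open>w\<close>.

  The half-space makes the sums finite and the \<open>P(\<nu>)\<close> polynomials. The coefficient of
  \<open>q\<^sup>k\<close> in \<open>P(\<nu>)\<close> vanishes unless \<open>\<nu>\<close> is a sum of \<open>k\<close> elements of \<open>\<Psi>\<close>
  (\<open>q_partition_series_nonzero_imp_sum\<close>), and a linear form that is positive on the finite set
  underlying \<open>\<Psi>\<close> bounds the number of summands in terms of \<open>\<nu>\<close>
  (\<open>open_half_space_imp_bounded_sums\<close>).
\<close>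


section \<open>The generating series\<close>

lemma lookup_single_one_mult:
  "Poly_Mapping.lookup (Poly_Mapping.single a 1 * f) \<nu> = Poly_Mapping.lookup f (\<nu> - a)"
  for f :: "'a::ab_group_add \<Rightarrow>\<^sub>0 int"
proof -
  have "(\<Sum>q. Poly_Mapping.lookup f q when \<nu> = l + q) = Poly_Mapping.lookup f (\<nu> - l)" for l
  proof -
    have "(\<lambda>q. Poly_Mapping.lookup f q when \<nu> = l + q)
        = (\<lambda>q. Poly_Mapping.lookup f q when q = \<nu> - l)"
      by (auto simp: fun_eq_iff when_def algebra_simps)
    then show ?thesis by (simp only: Sum_any_when_equal)
  qed
  then have "Poly_Mapping.lookup (Poly_Mapping.single a 1 * f) \<nu> =
      (\<Sum>l. Poly_Mapping.lookup (Poly_Mapping.single a (1::int)) l * Poly_Mapping.lookup f (\<nu> - l))"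
    by (simp add: lookup_mult)
  also have "\<dots> = (\<Sum>l. Poly_Mapping.lookup f (\<nu> - l) when l = a)"
    by (rule Sum_any.cong) (auto simp: lookup_single when_def)
  finally show ?thesis by simp
qed

definition geometric_fps :: "'a::ab_group_add \<Rightarrow> ('a \<Rightarrow>\<^sub>0 int) fps"
  where "geometric_fps \<gamma> = Abs_fps (\<lambda>n. Poly_Mapping.single (nmul n \<gamma>) 1)"

lemma geometric_fps_mult: "(1 - fps_X * fps_const (Poly_Mapping.single \<gamma> 1)) * geometric_fps \<gamma> = 1"
proof (rule fps_ext)
  fix n
  show "fps_nth ((1 - fps_X * fps_const (Poly_Mapping.single \<gamma> 1)) * geometric_fps \<gamma>) n
      = fps_nth 1 n"
    by (cases n) (simp_all add: geometric_fps_def left_diff_distrib mult.assoc mult_single nmul_Suc)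
qed

lemma ring_inv_eqI:
  assumes "u * v = (1 :: 'a::comm_ring_1)"
  shows "ring_inv u = v"
  unfolding ring_inv_def
proof (rule the_equality)
  fix v' assume "u * v' = 1"
  then have "v' = (u * v) * v'" "(u * v') * v = v" using assms by simp_all
  then show "v' = v" by (simp add: mult_ac)
qed fact

lemma q_partition_series_empty [simp]: "q_partition_series {#} = 1"
  by (simp add: q_partition_series_def)

lemma q_partition_series_add_mset [simp]:
  "q_partition_series (add_mset \<gamma> \<Psi>) = geometric_fps \<gamma> * q_partition_series \<Psi>"
  by (simp add: q_partition_series_def ring_inv_eqI[OF geometric_fps_mult])

lemma lookup_q_partition_series_add_mset:
  "Poly_Mapping.lookup (fps_nth (q_partition_series (add_mset \<gamma> \<Psi>)) k) \<nu> =
    (\<Sum>i\<le>k. Poly_Mapping.lookup (fps_nth (q_partition_series \<Psi>) (k - i)) (\<nu> - nmul i \<gamma>))"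
  by (simp add: fps_mult_nth geometric_fps_def lookup_sum lookup_single_one_mult atMost_atLeast0)

lemma sum_mset_replicate_mset: "sum_mset (replicate_mset n \<gamma>) = nmul n \<gamma>"
  by (induction n) (simp_all add: nmul_Suc)

text \<open>Every monomial in the expansion of the product picks \<open>k\<close> elements of \<open>\<Psi>\<close> with repetition.\<close>

lemma q_partition_series_nonzero_imp_sum:
  assumes "Poly_Mapping.lookup (fps_nth (q_partition_series \<Psi>) k) \<nu> \<noteq> 0"
  shows "\<exists>M. size M = k \<and> set_mset M \<subseteq> set_mset \<Psi> \<and> sum_mset M = \<nu>"
  using assms
proof (induction \<Psi> arbitrary: k \<nu>)
  case empty
  then have "k = 0 \<and> \<nu> = 0"
    by (auto simp: fps_one_nth lookup_one when_def split: if_splits)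
  then show ?case by simp
next
  case (add \<gamma> \<Psi>)
  then obtain i where i: "i \<le> k"
      "Poly_Mapping.lookup (fps_nth (q_partition_series \<Psi>) (k - i)) (\<nu> - nmul i \<gamma>) \<noteq> 0"
    unfolding lookup_q_partition_series_add_mset by (meson atMost_iff sum.not_neutral_contains_not_neutral)
  from add.IH[OF i(2)] obtain M where
    M: "size M = k - i" "set_mset M \<subseteq> set_mset \<Psi>" "sum_mset M = \<nu> - nmul i \<gamma>" by blast
  then have "size (M + replicate_mset i \<gamma>) = k \<and>
      set_mset (M + replicate_mset i \<gamma>) \<subseteq> set_mset (add_mset \<gamma> \<Psi>) \<and>
      sum_mset (M + replicate_mset i \<gamma>) = \<nu>"
    using i(1) by (auto simp: sum_mset_replicate_mset split: if_splits)
  then show ?case by blast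
qed

text \<open>Differentiate \<open>(1 - q e\<^sup>\<gamma>) E = 1\<close> and multiply by \<open>E\<close>.\<close>

lemma fps_deriv_geometric_fps:
  "fps_deriv (geometric_fps \<gamma>) =
    fps_const (Poly_Mapping.single \<gamma> 1) * geometric_fps \<gamma> * geometric_fps \<gamma>"
proof -
  let ?u = "1 - fps_X * fps_const (Poly_Mapping.single \<gamma> (1::int))"
  let ?c = "fps_const (Poly_Mapping.single \<gamma> (1::int))"
  let ?E = "geometric_fps \<gamma>"
  have "fps_deriv ?u = - ?c" "fps_deriv (?u * ?E) = 0"
    by (simp, simp only: geometric_fps_mult, simp)
  then have "?u * fps_deriv ?E = ?c * ?E"
    by (simp only: fps_deriv_mult mult_minus_left add_uminus_conv_diff right_minus_eq)
  then have "(?u * fps_deriv ?E) * ?E = ?c * ?E * ?E"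
    by (simp only:)
  then have "(?u * ?E) * fps_deriv ?E = ?c * ?E * ?E"
    by (simp only: mult_ac)
  then show ?thesis
    by (simp only: geometric_fps_mult mult_1_left)
qed

lemma fps_deriv_q_partition_series:
  "fps_deriv (q_partition_series \<Psi>) =
    (\<Sum>\<gamma>\<in>#\<Psi>. fps_const (Poly_Mapping.single \<gamma> 1) * geometric_fps \<gamma>) * q_partition_series \<Psi>"
  by (induction \<Psi>) (simp_all add: fps_deriv_geometric_fps algebra_simps)

lemma lookup_q_partition_series_Suc:
  "of_nat (Suc k) * Poly_Mapping.lookup (fps_nth (q_partition_series \<Psi>) (Suc k)) \<nu> =
    (\<Sum>\<gamma>\<in>#\<Psi>. \<Sum>i\<le>k.
      Poly_Mapping.lookup (fps_nth (q_partition_series \<Psi>) (k - i)) (\<nu> - nmul (Suc i) \<gamma>))"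
  (is "?lhs = _")
proof -
  let ?S = "q_partition_series \<Psi>"
  have of_nat: "Poly_Mapping.lookup (of_nat m * f) \<nu> = of_nat m * Poly_Mapping.lookup f \<nu>"
    for m and f :: "'a \<Rightarrow>\<^sub>0 int"
    by (induction m) (simp_all add: lookup_add algebra_simps)
  have "?lhs = Poly_Mapping.lookup (fps_nth (fps_deriv ?S) k) \<nu>"
    by (simp only: fps_deriv_nth of_nat Suc_eq_plus1)
  also have "\<dots> = Poly_Mapping.lookup (fps_nth
      ((\<Sum>\<gamma>\<in>#\<Psi>. fps_const (Poly_Mapping.single \<gamma> 1) * geometric_fps \<gamma>) * ?S) k) \<nu>"
    by (simp only: fps_deriv_q_partition_series)
  also have "\<dots> = (\<Sum>\<gamma>\<in>#\<Psi>. Poly_Mapping.lookup (fps_nth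
      (fps_const (Poly_Mapping.single \<gamma> 1) * geometric_fps \<gamma> * ?S) k) \<nu>)"
  proof -
    have "Poly_Mapping.lookup (fps_nth ((\<Sum>\<gamma>\<in>#\<Phi>. f \<gamma>) * ?S) k) \<nu> =
        (\<Sum>\<gamma>\<in>#\<Phi>. Poly_Mapping.lookup (fps_nth (f \<gamma> * ?S) k) \<nu>)"
      for \<Phi> :: "'a multiset" and f :: "'a \<Rightarrow> ('a \<Rightarrow>\<^sub>0 int) fps"
      by (induction \<Phi>) (simp_all add: distrib_right lookup_add)
    then show ?thesis .
  qed
  also have "\<dots> = (\<Sum>\<gamma>\<in>#\<Psi>. \<Sum>i\<le>k.
      Poly_Mapping.lookup (fps_nth ?S (k - i)) (\<nu> - nmul (Suc i) \<gamma>))"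
  proof -
    have "Poly_Mapping.lookup (fps_nth
        (fps_const (Poly_Mapping.single \<gamma> 1) * geometric_fps \<gamma> * ?S) k) \<nu> =
      Poly_Mapping.lookup (fps_nth (geometric_fps \<gamma> * ?S) k) (\<nu> - \<gamma>)" for \<gamma>
      by (simp only: mult.assoc fps_mult_left_const_nth lookup_single_one_mult)
    then show ?thesis
      by (simp add: fps_mult_nth geometric_fps_def lookup_sum lookup_single_one_mult
          atMost_atLeast0 nmul_Suc diff_diff_eq)
  qed
  finally show ?thesis .
qed


section \<open>The derivative of the q-partition function\<close>

text \<open>
  The bound \<open>b\<close> on the number of summands is a bound on the degree in \<open>q\<close>, so the coefficient
  of \<open>e\<^sup>\<nu>\<close> is a polynomial.
\<close>

lemma coeff_q_partition:
  assumes "\<And>M. set_mset M \<subseteq> set_mset \<Psi> \<Longrightarrow> sum_mset M = \<nu> \<Longrightarrow> size M \<le> b"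
  shows "coeff (q_partition \<Psi> \<nu>) k = Poly_Mapping.lookup (fps_nth (q_partition_series \<Psi>) k) \<nu>"
proof -
  have "Poly_Mapping.lookup (fps_nth (q_partition_series \<Psi>) i) \<nu> = 0" if "i > b" for i
    using q_partition_series_nonzero_imp_sum[of \<Psi> i \<nu>] assms that leD by blast
  then show ?thesis
    unfolding q_partition_def by (subst coeff_Abs_poly[of b]) simp_all
qed

text \<open>Appending \<open>n\<close> copies of \<open>\<gamma>\<close> turns a sum equal to \<open>\<nu> - n\<gamma>\<close> into a sum equal to \<open>\<nu>\<close>.\<close>

lemma bounded_sums_diff:
  assumes b: "\<And>M. set_mset M \<subseteq> set_mset \<Psi> \<Longrightarrow> sum_mset M = \<nu> \<Longrightarrow> size M \<le> b"
    and \<gamma>: "\<gamma> \<in># \<Psi>" and M: "set_mset M \<subseteq> set_mset \<Psi>" "sum_mset M = \<nu> - nmul n \<gamma>"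
  shows "size M + n \<le> b"
  using b[of "M + replicate_mset n \<gamma>"] \<gamma> M
  by (auto simp: sum_mset_replicate_mset split: if_splits)

lemma coeff_q_partition_diff:
  assumes b: "\<And>M. set_mset M \<subseteq> set_mset \<Psi> \<Longrightarrow> sum_mset M = \<nu> \<Longrightarrow> size M \<le> b"
    and \<gamma>: "\<gamma> \<in># \<Psi>"
  shows "coeff (q_partition \<Psi> (\<nu> - nmul n \<gamma>)) k =
    Poly_Mapping.lookup (fps_nth (q_partition_series \<Psi>) k) (\<nu> - nmul n \<gamma>)"
proof (rule coeff_q_partition)
  fix M assume "set_mset M \<subseteq> set_mset \<Psi>" "sum_mset M = \<nu> - nmul n \<gamma>"
  then show "size M \<le> b"
    using bounded_sums_diff[OF b \<gamma>] by (meson add_leD1)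
qed

lemma q_partition_diff_eq_0:
  assumes b: "\<And>M. set_mset M \<subseteq> set_mset \<Psi> \<Longrightarrow> sum_mset M = \<nu> \<Longrightarrow> size M \<le> b"
    and \<gamma>: "\<gamma> \<in># \<Psi>" and n: "b < n"
  shows "q_partition \<Psi> (\<nu> - nmul n \<gamma>) = 0"
proof (rule poly_eqI)
  fix k
  have "Poly_Mapping.lookup (fps_nth (q_partition_series \<Psi>) k) (\<nu> - nmul n \<gamma>) = 0"
    using q_partition_series_nonzero_imp_sum[of \<Psi> k "\<nu> - nmul n \<gamma>"]
      bounded_sums_diff[OF b \<gamma>] n by (meson add_leD2 leD)
  then show "coeff (q_partition \<Psi> (\<nu> - nmul n \<gamma>)) k = coeff 0 k"
    by (simp add: coeff_q_partition_diff[OF b \<gamma>])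
qed

lemma coeff_sum_mset: "coeff (\<Sum>x\<in>#A. f x) k = (\<Sum>x\<in>#A. coeff (f x) k)"
  by (induction A) simp_all

lemma pderiv_q_partition:
  assumes b: "\<And>M. set_mset M \<subseteq> set_mset \<Psi> \<Longrightarrow> sum_mset M = \<nu> \<Longrightarrow> size M \<le> b"
    and "b \<le> m"
  shows "pderiv (q_partition \<Psi> \<nu>) =
    (\<Sum>\<gamma>\<in>#\<Psi>. \<Sum>n\<in>{1..m}. monom 1 (n - 1) * q_partition \<Psi> (\<nu> - nmul n \<gamma>))"
proof (rule poly_eqI)
  fix k
  have zero: "q_partition \<Psi> (\<nu> - nmul n \<gamma>) = 0" if "\<gamma> \<in># \<Psi>" "m < n" for \<gamma> n
    using q_partition_diff_eq_0[OF b that(1) order.strict_trans1[OF \<open>b \<le> m\<close> that(2)]] by blast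
  let ?c = "\<lambda>j. Poly_Mapping.lookup (fps_nth (q_partition_series \<Psi>) j)"
  have eq: "(\<Sum>i\<le>k. ?c (k - i) (\<nu> - nmul (Suc i) \<gamma>)) =
      coeff (\<Sum>n\<in>{1..m}. monom 1 (n - 1) * q_partition \<Psi> (\<nu> - nmul n \<gamma>)) k" if \<gamma>: "\<gamma> \<in># \<Psi>" for \<gamma>
  proof -
    let ?d = "\<lambda>i. coeff (monom 1 i * q_partition \<Psi> (\<nu> - nmul (Suc i) \<gamma>)) k"
    have "(\<Sum>i\<le>k. ?c (k - i) (\<nu> - nmul (Suc i) \<gamma>)) = (\<Sum>i\<le>k. ?d i)"
      by (intro sum.cong) (simp_all add: coeff_monom_mult coeff_q_partition_diff[OF b \<gamma>])
    \<comment> \<open>Terms with \<open>i > k\<close> lie in degree above \<open>k\<close>; those with \<open>i \<ge> m \<ge> b\<close> vanish altogether.\<close>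
    also have "\<dots> = (\<Sum>i\<in>{..k} \<inter> {..<m}. ?d i)"
      using zero[OF \<gamma>, of "Suc _"]
      by (intro sum.mono_neutral_right) (auto simp: not_less less_Suc_eq_le)
    also have "\<dots> = (\<Sum>i<m. ?d i)"
      by (intro sum.mono_neutral_left) (auto simp: coeff_monom_mult)
    also have "\<dots> = (\<Sum>n\<in>{1..m}. coeff (monom 1 (n - 1) * q_partition \<Psi> (\<nu> - nmul n \<gamma>)) k)"
      by (rule sum.reindex_bij_witness[of _ "\<lambda>n. n - 1" Suc]) auto
    finally show ?thesis by (simp add: coeff_sum)
  qed
  have "coeff (pderiv (q_partition \<Psi> \<nu>)) k = of_nat (Suc k) * ?c (Suc k) \<nu>"
    by (simp only: coeff_pderiv coeff_q_partition[OF b])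
  also have "\<dots> = (\<Sum>\<gamma>\<in>#\<Psi>.
      coeff (\<Sum>n\<in>{1..m}. monom 1 (n - 1) * q_partition \<Psi> (\<nu> - nmul n \<gamma>)) k)"
    unfolding lookup_q_partition_series_Suc using eq
    by (intro arg_cong[of _ _ sum_mset] image_mset_cong) blast
  also have "\<dots> = coeff (\<Sum>\<gamma>\<in>#\<Psi>. \<Sum>n\<in>{1..m}. monom 1 (n - 1) * q_partition \<Psi> (\<nu> - nmul n \<gamma>)) k"
    by (simp add: coeff_sum_mset image_mset.compositionality comp_def)
  finally show "coeff (pderiv (q_partition \<Psi> \<nu>)) k =
      coeff (\<Sum>\<gamma>\<in>#\<Psi>. \<Sum>n\<in>{1..m}. monom 1 (n - 1) * q_partition \<Psi> (\<nu> - nmul n \<gamma>)) k" .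
qed


section \<open>Weights in an open half-space\<close>

lemma zero_in_char_group: "0 \<in> char_group T"
proof -
  have "regular_on T (\<lambda>t. 1)"
    unfolding regular_on_def by (rule bexI[of _ "\<lambda>A. 1"], rule exI[of _ 0]) (auto intro: polyfun.const)
  then show ?thesis
    by (simp add: char_group_def zero_nvfun.rep_eq)
qed

lemma add_in_char_group:
  assumes "x \<in> char_group T" "y \<in> char_group T"
  shows "x + y \<in> char_group T"
proof -
  have "regular_on T (ev x)" "regular_on T (ev y)"
    using assms by (auto simp: char_group_def)
  then obtain p q k l where pq: "p \<in> polyfun" "q \<in> polyfun"
      "\<forall>A\<in>T. ev x A = p A / det A ^ k" "\<forall>A\<in>T. ev y A = q A / det A ^ l"
    unfolding regular_on_def by metis
  then have "\<forall>A\<in>T. ev x A * ev y A = (p A * q A) / det A ^ (k + l)"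
    by (simp add: power_add)
  then have "regular_on T (\<lambda>t. ev x t * ev y t)"
    unfolding regular_on_def using polyfun.mult[OF pq(1,2)] by (intro bexI exI)
  then show ?thesis
    using assms by (simp add: char_group_def plus_nvfun.rep_eq)
qed

lemma nmul_in_char_group: "x \<in> char_group T \<Longrightarrow> nmul n x \<in> char_group T"
  by (induction n) (simp_all add: nmul_Suc zero_in_char_group add_in_char_group)

lemma qfrac_add:
  assumes "0 < m" "0 < n"
  shows "qfrac a m + qfrac b n = qfrac (nmul n a + nmul m b) (m * n)"
  using assms by transfer (auto simp: qfrac_rel_def)

lemma zero_in_rat_span: "0 \<in> rat_span (char_group T)"
proof -
  have "(0 :: 'a chr ratn) = qfrac 0 1"
    by transfer (auto simp: qfrac_rel_def)
  then show ?thesis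
    unfolding rat_span_def using zero_in_char_group by blast
qed

lemma add_in_rat_span:
  assumes "x \<in> rat_span (char_group T)" "y \<in> rat_span (char_group T)"
  shows "x + y \<in> rat_span (char_group T)"
proof -
  obtain a m b n where "x = qfrac a m" "y = qfrac b n" "0 < m" "0 < n"
      "a \<in> char_group T" "b \<in> char_group T"
    using assms unfolding rat_span_def by blast
  then show ?thesis
    unfolding rat_span_def using qfrac_add[of m n a b]
    by (auto intro!: exI[of _ "nmul n a + nmul m b"] exI[of _ "m * n"]
        add_in_char_group nmul_in_char_group)
qed

lemma \<iota>_add: "\<iota> (a + b) = \<iota> a + \<iota> b"
  by (simp add: qfrac_add)

lemma \<iota>_nmul: "\<iota> (nmul n a) = nmul n (\<iota> a)"
proof (induction n)
  case 0
  show ?case by simp (transfer, auto simp: qfrac_rel_def)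
qed (simp add: nmul_Suc \<iota>_add[unfolded One_nat_def])

text \<open>
  If \<open>\<delta> > 0\<close> is a lower bound on the finite set \<open>\<Psi>\<close> for the linear form defining the
  half-space, then the form is at least \<open>k \<delta>\<close> on every sum of \<open>k\<close> elements of \<open>\<Psi>\<close>.
\<close>

lemma open_half_space_imp_bounded_sums:
  assumes V: "0 \<in> V" "\<And>x y. x \<in> V \<Longrightarrow> y \<in> V \<Longrightarrow> x + y \<in> V"
    and H: "open_half_space V H" "set_mset \<Psi> \<subseteq> H"
  shows "\<exists>b. \<forall>M. set_mset M \<subseteq> set_mset \<Psi> \<longrightarrow> sum_mset M = \<nu> \<longrightarrow> size M \<le> b"
proof -
  obtain \<phi> :: "'a ratn \<Rightarrow> rat" where add: "\<And>x y. x \<in> V \<Longrightarrow> y \<in> V \<Longrightarrow> \<phi> (x + y) = \<phi> x + \<phi> y"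
    and H_eq: "H = {x \<in> V. 0 < \<phi> x}"
    using H(1) unfolding open_half_space_def by blast
  have \<phi>_0: "\<phi> 0 = 0"
    using add[OF V(1) V(1)] by simp
  \<comment> \<open>The \<open>1\<close> keeps the minimum meaningful when \<open>\<Psi>\<close> is empty.\<close>
  define \<delta> where "\<delta> = Min (insert 1 (\<phi> ` set_mset \<Psi>))"
  have \<delta>_pos: "0 < \<delta>"
    using H(2) by (auto simp: \<delta>_def H_eq)
  have \<delta>_le: "\<delta> \<le> \<phi> \<gamma>" if "\<gamma> \<in># \<Psi>" for \<gamma>
    using that by (simp add: \<delta>_def)
  have "sum_mset M \<in> V \<and> of_nat (size M) * \<delta> \<le> \<phi> (sum_mset M)"
    if "set_mset M \<subseteq> set_mset \<Psi>" for M
    using that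
  proof (induction M)
    case empty
    show ?case by (simp add: V \<phi>_0)
  next
    case (add \<gamma> M)
    then have "\<gamma> \<in># \<Psi>" "\<gamma> \<in> V" using H(2) by (auto simp: H_eq)
    with add \<delta>_le[of \<gamma>] show ?case
      by (auto simp: V \<open>\<And>x y. x \<in> V \<Longrightarrow> y \<in> V \<Longrightarrow> \<phi> (x + y) = \<phi> x + \<phi> y\<close> distrib_right)
  qed
  then have size_le: "of_nat (size M) \<le> \<phi> \<nu> / \<delta>" if "set_mset M \<subseteq> set_mset \<Psi>" "sum_mset M = \<nu>" for M
    using that \<delta>_pos by (auto simp: pos_le_divide_eq)
  obtain b :: nat where b: "\<phi> \<nu> / \<delta> \<le> of_nat b"
    using reals_Archimedean2 less_imp_le by blast
  have "size M \<le> b" if "set_mset M \<subseteq> set_mset \<Psi>" "sum_mset M = \<nu>" for M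
    using order.trans[OF size_le[OF that] b] by simp
  then show ?thesis by blast
qed


section \<open>Alternating sums of partition functions\<close>

lemma smult_sum_right: "smult c (\<Sum>i\<in>A. f i) = (\<Sum>i\<in>A. smult c (f i))"
  by (induction A rule: infinite_finite_induct) (simp_all add: smult_add_right)

text \<open>
  The identity for \<open>P\<close> is linear in \<open>P\<close> and commutes with translations, so it passes to any
  combination of translates. In \<open>mpoly\<close> the translations are \<open>a w = w(\<lambda> + \<rho>)\<close>, the coefficients
  \<open>c w = \<epsilon>(w)\<close>, and the argument is \<open>x = \<mu> + \<rho>\<close>. An infinite \<open>W\<close> makes \<open>F\<close> zero.
\<close>

lemma pderiv_sum_q_partition:
  fixes c :: "'i \<Rightarrow> int" and a :: "'i \<Rightarrow> 'a::ab_group_add"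
    and W :: "'i set" and \<Psi> :: "'a multiset"
  defines "F \<equiv> \<lambda>x. \<Sum>w\<in>W. smult (c w) (q_partition \<Psi> (a w - x))"
  assumes bounded: "\<And>\<nu>. \<exists>b. \<forall>M. set_mset M \<subseteq> set_mset \<Psi> \<longrightarrow> sum_mset M = \<nu> \<longrightarrow> size M \<le> b"
  shows "\<exists>m. (\<forall>\<gamma>\<in>#\<Psi>. \<forall>n>m. F (x + nmul n \<gamma>) = 0) \<and>
    pderiv (F x) = (\<Sum>\<gamma>\<in>#\<Psi>. \<Sum>n\<in>{1..m}. monom 1 (n - 1) * F (x + nmul n \<gamma>))"
proof (cases "finite W")
  case True
  from bounded obtain b where
    b: "\<And>\<nu> M. set_mset M \<subseteq> set_mset \<Psi> \<Longrightarrow> sum_mset M = \<nu> \<Longrightarrow> size M \<le> b \<nu>"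
    by metis
  define m where "m = Max (insert 0 ((\<lambda>w. b (a w - x)) ` W))"
  have m: "b (a w - x) \<le> m" if "w \<in> W" for w
    using that True by (simp add: m_def)
  have "F (x + nmul n \<gamma>) = 0" if "\<gamma> \<in># \<Psi>" "m < n" for \<gamma> n
  proof -
    have "q_partition \<Psi> (a w - x - nmul n \<gamma>) = 0" if "w \<in> W" for w
      using q_partition_diff_eq_0[OF b \<open>\<gamma> \<in># \<Psi>\<close> order.strict_trans1[OF m[OF that] \<open>m < n\<close>]]
      by blast
    then show ?thesis
      by (simp add: F_def diff_diff_eq)
  qed
  moreover have "pderiv (F x) = (\<Sum>\<gamma>\<in>#\<Psi>. \<Sum>n\<in>{1..m}. monom 1 (n - 1) * F (x + nmul n \<gamma>))"
  proof -
    have "pderiv (F x) = (\<Sum>w\<in>W. smult (c w) (pderiv (q_partition \<Psi> (a w - x))))"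
      by (simp add: F_def higher_pderiv_sum[of 1, simplified] pderiv_smult)
    also have "\<dots> = (\<Sum>w\<in>W. smult (c w)
        (\<Sum>\<gamma>\<in>#\<Psi>. \<Sum>n\<in>{1..m}. monom 1 (n - 1) * q_partition \<Psi> (a w - x - nmul n \<gamma>)))"
      using pderiv_q_partition[OF b m] by (intro sum.cong) simp_all
    also have "\<dots> = (\<Sum>\<gamma>\<in>#\<Psi>. \<Sum>w\<in>W. smult (c w)
        (\<Sum>n\<in>{1..m}. monom 1 (n - 1) * q_partition \<Psi> (a w - x - nmul n \<gamma>)))"
    proof -
      have "(\<Sum>w\<in>W. smult (c w) (\<Sum>\<gamma>\<in>#\<Phi>. f w \<gamma>)) = (\<Sum>\<gamma>\<in>#\<Phi>. \<Sum>w\<in>W. smult (c w) (f w \<gamma>))"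
        for \<Phi> :: "'a multiset" and f :: "'i \<Rightarrow> 'a \<Rightarrow> int poly"
        by (induction \<Phi>) (simp_all add: smult_add_right sum.distrib)
      then show ?thesis .
    qed
    also have "\<dots> = (\<Sum>\<gamma>\<in>#\<Psi>. \<Sum>n\<in>{1..m}. monom 1 (n - 1) * F (x + nmul n \<gamma>))"
    proof -
      have "(\<Sum>w\<in>W. smult (c w)
          (\<Sum>n\<in>{1..m}. monom 1 (n - 1) * q_partition \<Psi> (a w - x - nmul n \<gamma>)))
        = (\<Sum>w\<in>W. \<Sum>n\<in>{1..m}. monom 1 (n - 1) *
            smult (c w) (q_partition \<Psi> (a w - x - nmul n \<gamma>)))" for \<gamma>
        by (simp add: smult_sum_right)
      also have "\<dots> \<gamma> = (\<Sum>n\<in>{1..m}. monom 1 (n - 1) * F (x + nmul n \<gamma>))" for \<gamma>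
        unfolding F_def sum_distrib_left diff_diff_eq by (rule sum.swap)
      finally show ?thesis by simp
    qed
    finally show ?thesis .
  qed
  ultimately show ?thesis by blast
qed (simp add: F_def)

theorem corollary2p2:
  fixes G B T P :: "'n::finite mat set"
    and rep :: "'n mat \<Rightarrow> 'm::finite mat"
    and N :: "(complex^'m) set"
    and \<Psi> :: "'n chr multiset"
    and lam \<mu> :: "'n chr"
  assumes "connected_semisimple G"
    and "borel_subgroup G B"
    and "maximal_torus G T" and "T \<subseteq> B"
    and "parabolic_subgroup G P" and "B \<subseteq> P"
    and "rational_module G rep"
    and "stable_subspace P rep N"
    and "\<Psi> = weights_mset T rep N"
    and "\<exists>H. open_half_space (rat_span (char_group T)) H \<and> \<iota> ` set_mset \<Psi> \<subseteq> H"
    and "lam \<in> dominant_weights G B T"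
    and "\<mu> \<in> char_group T"
  shows "(\<forall>\<gamma>\<in>#\<Psi>. finite {n. 1 \<le> n \<and> mpoly G B T \<Psi> lam (\<mu> + nmul n \<gamma>) \<noteq> 0}) \<and>
    pderiv (mpoly G B T \<Psi> lam \<mu>) =
      (\<Sum>\<gamma>\<in>#\<Psi>. \<Sum>n | 1 \<le> n \<and> mpoly G B T \<Psi> lam (\<mu> + nmul n \<gamma>) \<noteq> 0.
        monom 1 (n - 1) * mpoly G B T \<Psi> lam (\<mu> + nmul n \<gamma>))"
proof -
  let ?V = "rat_span (char_group T)"
  let ?m = "mpoly G B T \<Psi> lam"
  define \<rho> where "\<rho> = half_sum_pos_roots B T"
  define F where "F = (\<lambda>x. \<Sum>w\<in>carrier (weyl G T). smult ((- 1) ^ weyl_length G B T w)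
    (q_partition (image_mset \<iota> \<Psi>) (map_ratn (weyl_act T w) (\<iota> lam + \<rho>) - x)))"
  have sign: "(- 1) ^ k * p = smult ((- 1) ^ k) p" for k and p :: "int poly"
    by (induction k) simp_all
  have mpoly_eq: "?m x = F (\<iota> x + \<rho>)" for x
    by (simp only: mpoly_def Let_def F_def \<rho>_def sign)
  have mpoly_shift: "?m (\<mu> + nmul n \<gamma>) = F (\<iota> \<mu> + \<rho> + nmul n (\<iota> \<gamma>))" for n \<gamma>
    by (simp only: mpoly_eq \<iota>_add \<iota>_nmul add_ac)
  from assms(10) obtain H where H: "open_half_space ?V H" "set_mset (image_mset \<iota> \<Psi>) \<subseteq> H"
    by auto
  have "\<exists>m. (\<forall>\<gamma>\<in>#image_mset \<iota> \<Psi>. \<forall>n>m. F (\<iota> \<mu> + \<rho> + nmul n \<gamma>) = 0) \<and>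
      pderiv (F (\<iota> \<mu> + \<rho>)) =
        (\<Sum>\<gamma>\<in>#image_mset \<iota> \<Psi>. \<Sum>n\<in>{1..m}. monom 1 (n - 1) * F (\<iota> \<mu> + \<rho> + nmul n \<gamma>))"
    unfolding F_def
    by (intro pderiv_sum_q_partition open_half_space_imp_bounded_sums[OF _ _ H]
        zero_in_rat_span add_in_rat_span)
  then obtain m where zero: "\<And>\<gamma> n. \<gamma> \<in># \<Psi> \<Longrightarrow> m < n \<Longrightarrow> ?m (\<mu> + nmul n \<gamma>) = 0"
    and deriv: "pderiv (?m \<mu>) =
      (\<Sum>\<gamma>\<in>#\<Psi>. \<Sum>n\<in>{1..m}. monom 1 (n - 1) * ?m (\<mu> + nmul n \<gamma>))"
    unfolding mpoly_shift unfolding mpoly_eq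
    by (auto simp: image_mset.compositionality comp_def)
  have sub: "{n. 1 \<le> n \<and> ?m (\<mu> + nmul n \<gamma>) \<noteq> 0} \<subseteq> {1..m}" if "\<gamma> \<in># \<Psi>" for \<gamma>
    using zero[OF that] by (auto simp: not_less[symmetric])
  have "(\<Sum>n\<in>{1..m}. monom 1 (n - 1) * ?m (\<mu> + nmul n \<gamma>)) =
      (\<Sum>n | 1 \<le> n \<and> ?m (\<mu> + nmul n \<gamma>) \<noteq> 0. monom 1 (n - 1) * ?m (\<mu> + nmul n \<gamma>))"
    if "\<gamma> \<in># \<Psi>" for \<gamma>
    using sub[OF that] by (intro sum.mono_neutral_right) auto
  then have "(\<Sum>\<gamma>\<in>#\<Psi>. \<Sum>n\<in>{1..m}. monom 1 (n - 1) * ?m (\<mu> + nmul n \<gamma>)) =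
      (\<Sum>\<gamma>\<in>#\<Psi>. \<Sum>n | 1 \<le> n \<and> ?m (\<mu> + nmul n \<gamma>) \<noteq> 0.
        monom 1 (n - 1) * ?m (\<mu> + nmul n \<gamma>))"
    by (intro arg_cong[of _ _ sum_mset] image_mset_cong) blast
  moreover have "\<forall>\<gamma>\<in>#\<Psi>. finite {n. 1 \<le> n \<and> ?m (\<mu> + nmul n \<gamma>) \<noteq> 0}"
    using sub finite_subset[OF _ finite_atLeastAtMost] by blast
  ultimately show ?thesis
    using deriv by (simp only: simp_thms)
qed

end
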